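(* Let $n\ge 2$ and let $X_1,\dots,X_n$ be independent real random variables, where $X_i$ has the law $P_{\theta_i^\star}$ of a regular one-parameter exponential family $\{P_\theta\}_{\theta\in\Theta}$ (the same family for all $i$) with parameter $\theta_i^\star\in\Theta$; put $\mu_i^\star=\mathbb{E}[X_i]=b'(\theta_i^\star)$. Let $\pi^\star$ be a permutation of $\{1,\dots,n\}$ with $\mu^\star_{\pi^\star(1)}\ge\mu^\star_{\pi^\star(2)}\ge\cdots\ge\mu^\star_{\pi^\star(n)}$. For a permutation $\pi$ of $\{1,\dots,n\}$, let $\widehat{\boldsymbol\mu}^{\pi}=(\widehat\mu^\pi_1,\dots,\widehat\mu^\pi_n)$ be the unique minimizer of $$\sum_{i=1}^n (X_i-\mu_i)^2\quad\text{subject to}\quad \mu_{\pi(1)}\ge\mu_{\pi(2)}\ge\cdots\ge\mu_{\pi(n)}.$$ Let $U:\mathbb{R}\to\mathbb{R}$ be a nondecreasing convex function and define $$\mathsf{Util}(\pi)=\mathbb{E}\Big[\sum_{i=1}^n U(\widehat\mu^\pi_i)\Big].$$ Then $\mathsf{Util}(\pi^\star)\ge\mathsf{Util}(\pi)$ for every permutation $\pi$ of $\{1,\dots,n\}$.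
   Context: Regular one-parameter exponential family: there are a base measure $\rho$ on $\mathbb{R}$, a carrier function $c\ge 0$, an open interval $\Theta\subseteq\mathbb{R}$, and a log-partition function $b:\Theta\to\mathbb{R}$ such that for each $\theta\in\Theta$, $P_\theta$ has density $p_\theta(x)=e^{\theta x-b(\theta)}c(x)$ with respect to $\rho$; $b$ is twice differentiable with $b''(\theta)>0$ on $\Theta$. One has $\mathbb{E}_\theta[X]=b'(\theta)$ and $\mathrm{Var}_\theta(X)=b''(\theta)\in(0,\infty)$. Since a nondecreasing convex $U$ is bounded below by an affine function and the $X_i$ are integrable, the expectations defining $\mathsf{Util}$ are well defined in $(-\infty,+\infty]$. *)

theory Defs
  imports "HOL-Probability.Probability" "HOL-Combinatorics.Permutations"
begin

definition exp_family_law ::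
  "real measure \<Rightarrow> (real \<Rightarrow> real) \<Rightarrow> (real \<Rightarrow> real) \<Rightarrow> real \<Rightarrow> real measure" where
  "exp_family_law \<rho> c b \<theta> = density \<rho> (\<lambda>x. ennreal (exp (\<theta> * x - b \<theta>) * c x))"

text \<open>
  The log-partition function is a total function here, but only its values on the
  parameter interval matter: that interval is open, so the derivatives are determined there.
  The identities for the mean and the variance are consequences and are not assumed.
\<close>

definition regular_exp_family ::
  "real measure \<Rightarrow> (real \<Rightarrow> real) \<Rightarrow> real set \<Rightarrow> (real \<Rightarrow> real) \<Rightarrow> bool" where
  "regular_exp_family \<rho> c \<Theta> b \<longleftrightarrow>
     sets \<rho> = sets borel \<and>
     c \<in> borel_measurable borel \<and> (\<forall>x. 0 \<le> c x) \<and>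
     open \<Theta> \<and> is_interval \<Theta> \<and>
     (\<forall>\<theta>\<in>\<Theta>. prob_space (exp_family_law \<rho> c b \<theta>)) \<and>
     (\<forall>\<theta>\<in>\<Theta>. b differentiable (at \<theta>) \<and> deriv b differentiable (at \<theta>) \<and>
            0 < deriv (deriv b) \<theta>)"

definition nonincreasing_along :: "nat \<Rightarrow> (nat \<Rightarrow> nat) \<Rightarrow> (nat \<Rightarrow> real) \<Rightarrow> bool" where
  "nonincreasing_along n \<pi> \<mu> \<longleftrightarrow> (\<forall>k. 1 \<le> k \<and> k < n \<longrightarrow> \<mu> (\<pi> k) \<ge> \<mu> (\<pi> (k + 1)))"

text \<open>
  Vectors with coordinates 1, ..., n are functions on the naturals; candidates are taken in
  \<^term>\<open>extensional {1..n}\<close>, since otherwise their values outside the index set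
  would be arbitrary and the minimizer not unique.
\<close>

definition isotonic_fit :: "nat \<Rightarrow> (nat \<Rightarrow> nat) \<Rightarrow> (nat \<Rightarrow> real) \<Rightarrow> nat \<Rightarrow> real" where
  "isotonic_fit n \<pi> x =
     (THE \<mu>. is_arg_min (\<lambda>\<mu>. \<Sum>i=1..n. (x i - \<mu> i)\<^sup>2)
               (\<lambda>\<mu>. \<mu> \<in> extensional {1..n} \<and> nonincreasing_along n \<pi> \<mu>) \<mu>)"

text \<open>
  The Bochner integral of a non-integrable function is 0, so an expectation that may be
  infinite is the difference of the integrals of the positive and the negative part.
  It is meaningful when one of these is finite.
\<close>

definition ext_expectation :: "'a measure \<Rightarrow> ('a \<Rightarrow> real) \<Rightarrow> ereal" where
  "ext_expectation M f =
     enn2ereal (\<integral>\<^sup>+ \<omega>. ennreal (f \<omega>) \<partial>M) - enn2ereal (\<integral>\<^sup>+ \<omega>. ennreal (- f \<omega>) \<partial>M)"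

lemma ext_expectation_eq_integral:
  assumes "integrable M f"
  shows "ext_expectation M f = ereal (\<integral>\<omega>. f \<omega> \<partial>M)"
proof -
  have *: "enn2ereal (\<integral>\<^sup>+ \<omega>. ennreal (g \<omega>) \<partial>M) = ereal (enn2real (\<integral>\<^sup>+ \<omega>. ennreal (g \<omega>) \<partial>M))"
    if "integrable M g" for g :: "'a \<Rightarrow> real"
  proof -
    have "(\<integral>\<^sup>+ \<omega>. ennreal (g \<omega>) \<partial>M) < \<infinity>"
      using real_integrable_def[of M g] that by (simp add: less_top)
    then show ?thesis
      by (metis enn2ereal_ennreal enn2real_nonneg ennreal_enn2real infinity_ennreal_def)
  qed
  show ?thesis
    unfolding ext_expectation_def real_lebesgue_integral_def[OF assms]
    using *[OF assms] *[of "\<lambda>\<omega>. - f \<omega>"] assms by simp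
qed

definition Util ::
  "'a measure \<Rightarrow> nat \<Rightarrow> (nat \<Rightarrow> 'a \<Rightarrow> real) \<Rightarrow> (real \<Rightarrow> real) \<Rightarrow> (nat \<Rightarrow> nat) \<Rightarrow> ereal" where
  "Util M n X U \<pi> =
     ext_expectation M (\<lambda>\<omega>. \<Sum>i=1..n. U (isotonic_fit n \<pi> (\<lambda>j. X j \<omega>) i))"

end

theory Submission imports Defs begin

text \<open>
  The fit along \<open>\<pi>\<close> is the projection of \<open>y = X \<circ> \<pi>\<close> onto the cone of nonincreasing sequences.
  Let \<open>y\<close> arise from \<open>y'\<close> by moving the larger of two neighbouring entries to the front, let
  \<open>m\<close>, \<open>m'\<close> be the projections and \<open>g\<close> a subgradient of \<open>U\<close>. The sequence \<open>z = g \<circ> m'\<close> lies in the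
  cone, so \<open>\<langle>y - m, z\<rangle> \<le> 0\<close>, \<open>\<langle>y - y', z\<rangle> \<ge> 0\<close> and \<open>\<langle>y' - m', z\<rangle> = 0\<close>, whence
  \<open>\<Sum>U(m) - \<Sum>U(m') \<ge> \<langle>m - m', z\<rangle> \<ge> 0\<close>. For two independent observations with a monotone
  likelihood ratio, this pointwise inequality integrates to the statement that putting the one
  with the larger mean first cannot decrease the utility. Adjacent transpositions of this kind
  turn every permutation into \<open>\<pi>s\<close>.
\<close>

section \<open>Convexity and first-order optimality\<close>

text \<open>First-order condition: a quadratic that vanishes at 0 and is nonnegative just to the
  right of 0 cannot have a negative slope \<open>- 2 * q\<close> there.\<close>

lemma linear_coeff_nonpos:
  fixes q s :: real
  assumes "\<And>t. 0 < t \<Longrightarrow> t \<le> 1 \<Longrightarrow> 0 \<le> t\<^sup>2 * s - 2 * t * q"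
  shows "q \<le> 0"
proof (rule ccontr)
  assume "\<not> q \<le> 0"
  then have q: "q > 0" by simp
  \<comment> \<open>Small enough for \<open>t * s \<le> q\<close>, so the quadratic is at most
    \<open>- t * q < 0\<close>.\<close>
  define t where "t = q / (q + \<bar>s\<bar>)"
  have pos: "q + \<bar>s\<bar> > 0" using q by linarith
  have t: "0 < t" "t \<le> 1" using q pos by (auto simp: t_def)
  have "t * s \<le> t * (q + \<bar>s\<bar>)" using q t by (intro mult_left_mono) auto
  also have "\<dots> = q" using pos by (simp add: t_def)
  finally have "t * (t * s) \<le> t * q" using t by (intro mult_left_mono) auto
  moreover have "t * q > 0" using t q by simp
  ultimately show False using assms[OF t] by (simp add: power2_eq_square algebra_simps)
qed

lemma nonincreasing_along_add_scaled:
  assumes "nonincreasing_along n \<pi> \<mu>" "nonincreasing_along n \<pi> \<nu>" "0 \<le> t" "t \<le> (1::real)"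
  shows "nonincreasing_along n \<pi> (\<lambda>i. (1 - t) * \<mu> i + t * \<nu> i)"
  using assms by (auto simp: nonincreasing_along_def intro!: add_mono mult_left_mono)

subsection \<open>Isotonic regression as a projection onto a cone\<close>

definition sq_dist :: "nat \<Rightarrow> (nat \<Rightarrow> real) \<Rightarrow> (nat \<Rightarrow> real) \<Rightarrow> real" where
  "sq_dist n x \<mu> = (\<Sum>i=1..n. (x i - \<mu> i)\<^sup>2)"

abbreviation fit_min :: "nat \<Rightarrow> (nat \<Rightarrow> nat) \<Rightarrow> (nat \<Rightarrow> real) \<Rightarrow> (nat \<Rightarrow> real) \<Rightarrow> bool" where
  "fit_min n \<pi> x \<equiv> is_arg_min (sq_dist n x)
     (\<lambda>\<mu>. \<mu> \<in> extensional {1..n} \<and> nonincreasing_along n \<pi> \<mu>)"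

text \<open>Candidates no farther from \<open>x\<close> than the zero vector lie in a compact box,
  on which the continuous distance attains its infimum. Other orders than \<open>id\<close> are
  reduced to this one by relabelling.\<close>

lemma fit_min_exists:
  "\<exists>\<mu>. fit_min n id x \<mu>"
proof -
  define D where "D = sq_dist n x (\<lambda>_. 0)"
  have D0: "D \<ge> 0" by (simp add: D_def sq_dist_def sum_nonneg)
  \<comment> \<open>Outside the index set the factor is the single point \<open>undefined\<close>:
    compact, and an encoding of membership in \<open>extensional {1..n}\<close>.\<close>
  define B where "B i = (if i \<in> {1..n} then {x i - sqrt D..x i + sqrt D} else {undefined})" for i
  have "compactin (product_topology (\<lambda>i::nat. euclidean :: real topology) UNIV) (PiE UNIV B)"
    by (subst compactin_PiE) (auto simp: B_def)
  then have cB: "compact (PiE UNIV B)" by (simp add: euclidean_product_topology)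
  have "closed {\<mu> :: nat \<Rightarrow> real. nonincreasing_along n id \<mu>}"
    unfolding nonincreasing_along_def
    by (intro closed_Collect_all closed_Collect_imp open_Collect_const closed_Collect_le) auto
  then have comp: "compact (PiE UNIV B \<inter> {\<mu>. nonincreasing_along n id \<mu>})" (is "compact ?C")
    using cB by (rule compact_Int_closed[rotated])
  define z where "z = restrict (\<lambda>_. 0::real) {1..n}"
  have Dz: "sq_dist n x z = D"
    by (simp add: D_def sq_dist_def z_def)
  have zc: "nonincreasing_along n id z"
    by (auto simp: nonincreasing_along_def z_def)
  have inC: "\<mu> \<in> ?C" if "\<mu> \<in> extensional {1..n}" "nonincreasing_along n id \<mu>" "sq_dist n x \<mu> \<le> D" for \<mu>
  proof -
    have "\<mu> i \<in> B i" for i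
    proof (cases "i \<in> {1..n}")
      case True
      have "(x i - \<mu> i)\<^sup>2 \<le> sq_dist n x \<mu>"
        unfolding sq_dist_def using True by (intro member_le_sum) auto
      then have "\<bar>x i - \<mu> i\<bar> \<le> sqrt D" using that(3)
        by (metis order_trans real_sqrt_abs real_sqrt_le_mono)
      then show ?thesis using True by (auto simp: B_def abs_le_iff)
    next
      case False then show ?thesis using that(1) by (auto simp: B_def extensional_def)
    qed
    then show ?thesis using that(2) by auto
  qed
  have zC: "z \<in> ?C" using Dz zc by (intro inC) (auto simp: z_def)
  have cont: "continuous_on ?C (sq_dist n x)"
    unfolding sq_dist_def
    by (intro continuous_intros continuous_on_subset[OF continuous_on_product_coordinates]) auto
  obtain m where m: "m \<in> ?C" "\<And>y. y \<in> ?C \<Longrightarrow> sq_dist n x m \<le> sq_dist n x y"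
    using continuous_attains_inf[OF comp _ cont] zC by blast
  have "m \<in> extensional {1..n}"
    using m(1) by (auto simp: extensional_def B_def PiE_def Pi_def split: if_splits)
  moreover have "\<not> sq_dist n x \<mu> < sq_dist n x m"
    if "\<mu> \<in> extensional {1..n}" "nonincreasing_along n id \<mu>" for \<mu>
    using inC[OF that] m(2)[OF zC] m(2)[of \<mu>] Dz by fastforce
  ultimately show ?thesis using m(1) by (auto simp: is_arg_min_def)
qed

text \<open>Obtuse-angle criterion for projections onto convex sets: the segment from
  \<open>m\<close> to \<open>z\<close> stays feasible, and the squared distance along it is a
  quadratic in \<open>t\<close> that is minimal at 0.\<close>

lemma fit_min_variational:
  assumes "fit_min n \<pi> x m" "nonincreasing_along n \<pi> z" "\<pi> permutes {1..n}"
  shows "(\<Sum>i=1..n. (x i - m i) * (z i - m i)) \<le> 0"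
proof (rule linear_coeff_nonpos[where s = "\<Sum>i=1..n. (z i - m i)\<^sup>2"])
  fix t :: real assume t: "0 < t" "t \<le> 1"
  define w where "w = restrict (\<lambda>i. (1 - t) * m i + t * z i) {1..n}"
  have in_range: "\<pi> k \<in> {1..n}" if "k \<in> {1..n}" for k
    using permutes_in_image[OF assms(3)] that by simp
  have "nonincreasing_along n \<pi> (\<lambda>i. (1 - t) * m i + t * z i)"
    using assms(1,2) t by (intro nonincreasing_along_add_scaled) (auto simp: is_arg_min_def)
  then have "nonincreasing_along n \<pi> w"
    using in_range by (auto simp: nonincreasing_along_def w_def)
  then have "sq_dist n x m \<le> sq_dist n x w"
    using assms(1) by (auto simp: is_arg_min_def w_def not_less)
  also have "sq_dist n x w = (\<Sum>i=1..n. (x i - m i)\<^sup>2 + (t\<^sup>2 * (z i - m i)\<^sup>2 - 2 * t * ((x i - m i) * (z i - m i))))"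
    unfolding sq_dist_def by (intro sum.cong) (auto simp: w_def power2_eq_square algebra_simps)
  also have "\<dots> = sq_dist n x m + (t\<^sup>2 * (\<Sum>i=1..n. (z i - m i)\<^sup>2) - 2 * t * (\<Sum>i=1..n. (x i - m i) * (z i - m i)))"
    by (simp add: sq_dist_def sum.distrib sum_subtractf sum_distrib_left)
  finally show "0 \<le> t\<^sup>2 * (\<Sum>i=1..n. (z i - m i)\<^sup>2) - 2 * t * (\<Sum>i=1..n. (x i - m i) * (z i - m i))"
    by simp
qed

text \<open>Each minimizer is tested against the other and the two inequalities are added; what
  remains in coordinate \<open>i\<close> is the square of \<open>(x i - y i) - (m i - m' i)\<close>.
  Uniqueness and continuity of the fit both rest on this.\<close>

lemma fit_min_nonexpansive:
  assumes "fit_min n \<pi> x m" "fit_min n \<pi> y m'" "\<pi> permutes {1..n}"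
  shows "sq_dist n m m' \<le> sq_dist n x y"
proof -
  have "(\<Sum>i=1..n. (x i - m i) * (m' i - m i)) + (\<Sum>i=1..n. (y i - m' i) * (m i - m' i)) \<le> 0"
    using fit_min_variational[OF assms(1) _ assms(3), of m'] fit_min_variational[OF assms(2) _ assms(3), of m]
      assms(1,2) by (auto simp: is_arg_min_def)
  moreover have "(\<Sum>i=1..n. (m i - m' i)\<^sup>2) \<le> (\<Sum>i=1..n. (x i - y i)\<^sup>2 +
      2 * ((x i - m i) * (m' i - m i) + (y i - m' i) * (m i - m' i)))"
  proof (intro sum_mono)
    fix i
    have "0 \<le> ((x i - y i) - (m i - m' i))\<^sup>2" by simp
    then show "(m i - m' i)\<^sup>2 \<le> (x i - y i)\<^sup>2 + 2 * ((x i - m i) * (m' i - m i) + (y i - m' i) * (m i - m' i))"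
      by (simp add: power2_eq_square algebra_simps)
  qed
  ultimately show ?thesis
    by (simp add: sq_dist_def sum.distrib flip: sum_distrib_left)
qed

lemma fit_min_unique:
  assumes "fit_min n \<pi> x m" "fit_min n \<pi> x m'" "\<pi> permutes {1..n}"
  shows "m = m'"
proof
  fix i
  have "sq_dist n m m' \<le> 0"
    using fit_min_nonexpansive[OF assms] by (simp add: sq_dist_def)
  then have "sq_dist n m m' = 0" by (intro antisym) (auto simp: sq_dist_def sum_nonneg)
  then have "m i = m' i" if "i \<in> {1..n}"
    using that by (simp add: sq_dist_def sum_nonneg_eq_0_iff)
  moreover have "m i = m' i" if "i \<notin> {1..n}"
    using that assms(1,2) by (auto simp: is_arg_min_def extensional_def)
  ultimately show "m i = m' i" by blast
qed

lemma isotonic_fit_eqI: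
  assumes "fit_min n \<pi> x m" "\<pi> permutes {1..n}"
  shows "isotonic_fit n \<pi> x = m"
  unfolding isotonic_fit_def sq_dist_def[symmetric]
  using assms fit_min_unique by (intro the_equality) blast+

lemma fit_min_isotonic_fit: "fit_min n id x (isotonic_fit n id x)"
proof -
  obtain m where m: "fit_min n id x m" using fit_min_exists by blast
  show ?thesis unfolding isotonic_fit_eqI[OF m permutes_id] by (rule m)
qed

lemma isotonic_fit_cong:
  assumes "\<And>i. i \<in> {1..n} \<Longrightarrow> x i = y i"
  shows "isotonic_fit n \<pi> x = isotonic_fit n \<pi> y"
proof -
  have "sq_dist n x = sq_dist n y"
    using assms by (auto simp: sq_dist_def fun_eq_iff intro!: sum.cong)
  then show ?thesis
    unfolding isotonic_fit_def sq_dist_def[symmetric] by simp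
qed

text \<open>Relabelling by \<open>\<pi>\<close> carries the cone along \<open>\<pi>\<close> to the
  fixed cone along \<open>id\<close>, so that from here on only the data depend on the
  permutation.\<close>

lemma isotonic_fit_permute:
  assumes \<pi>: "\<pi> permutes {1..n}" and i: "i \<in> {1..n}"
  shows "isotonic_fit n \<pi> x (\<pi> i) = isotonic_fit n id (x \<circ> \<pi>) i"
proof -
  have in_range: "\<pi> k \<in> {1..n} \<longleftrightarrow> k \<in> {1..n}" for k
    using permutes_in_image[OF \<pi>] by blast
  have dist: "sq_dist n x \<mu> = sq_dist n (x \<circ> \<pi>) (restrict (\<mu> \<circ> \<pi>) {1..n})" for \<mu>
    unfolding sq_dist_def by (subst sum.permute[OF \<pi>]) simp
  let ?m = "isotonic_fit n id (x \<circ> \<pi>)"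
  have m: "fit_min n id (x \<circ> \<pi>) ?m" by (rule fit_min_isotonic_fit)
  define m where "m = restrict (?m \<circ> inv \<pi>) {1..n}"
  have m_\<pi>: "m (\<pi> k) = ?m k" if "k \<in> {1..n}" for k
    using that in_range permutes_inverses(2)[OF \<pi>] by (simp add: m_def del: atLeastAtMost_iff)
  have "fit_min n \<pi> x m"
    unfolding is_arg_min_def
  proof (intro conjI allI notI)
    show "m \<in> extensional {1..n}" by (simp add: m_def)
    show "nonincreasing_along n \<pi> m"
      using m m_\<pi> by (auto simp: is_arg_min_def nonincreasing_along_def)
    have "restrict (m \<circ> \<pi>) {1..n} = ?m"
      using m m_\<pi> by (auto simp: is_arg_min_def fun_eq_iff extensional_def)
    then have mm: "sq_dist n x m = sq_dist n (x \<circ> \<pi>) ?m" by (simp only: dist[of m])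
    assume "\<exists>\<mu>. (\<mu> \<in> extensional {1..n} \<and> nonincreasing_along n \<pi> \<mu>) \<and> sq_dist n x \<mu> < sq_dist n x m"
    then obtain \<mu> where \<mu>: "nonincreasing_along n \<pi> \<mu>" "sq_dist n x \<mu> < sq_dist n x m" by blast
    have "nonincreasing_along n id (restrict (\<mu> \<circ> \<pi>) {1..n})"
      using \<mu>(1) by (auto simp: nonincreasing_along_def)
    with m have "\<not> sq_dist n (x \<circ> \<pi>) (restrict (\<mu> \<circ> \<pi>) {1..n}) < sq_dist n (x \<circ> \<pi>) ?m"
      by (auto simp: is_arg_min_def)
    with \<mu>(2) mm show False by (simp add: dist[of \<mu>])
  qed
  then have "isotonic_fit n \<pi> x = m" using \<pi> by (rule isotonic_fit_eqI)
  then show ?thesis using m_\<pi>[OF i] by simp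
qed

text \<open>The cone is closed under addition, so the fit plus \<open>z\<close> is a competitor in
  the variational inequality.\<close>

lemma isotonic_fit_normal_cone:
  assumes "nonincreasing_along n id z"
  shows "(\<Sum>i=1..n. (x i - isotonic_fit n id x i) * z i) \<le> 0"
proof -
  let ?m = "isotonic_fit n id x"
  have "nonincreasing_along n id (\<lambda>i. ?m i + z i)"
    using assms fit_min_isotonic_fit[of n x]
    by (auto simp: is_arg_min_def nonincreasing_along_def intro: add_mono)
  from fit_min_variational[OF fit_min_isotonic_fit[of n x] this permutes_id] show ?thesis by simp
qed

text \<open>The fit minus a small multiple of \<open>g \<circ> fit\<close> is still nonincreasing, because \<open>g\<close> only jumps
  where the fit does and there are finitely many jumps.\<close>

lemma isotonic_fit_orthogonal:
  "0 \<le> (\<Sum>i=1..n. (x i - isotonic_fit n id x i) * g (isotonic_fit n id x i))"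
proof -
  define m where "m = isotonic_fit n id x"
  have m: "fit_min n id x m" unfolding m_def by (rule fit_min_isotonic_fit)
  have mono: "m (k + 1) \<le> m k" if "k \<in> {1..<n}" for k
    using m that by (auto simp: is_arg_min_def nonincreasing_along_def)
  have "\<forall>\<^sub>F e in at_right 0. \<forall>k\<in>{1..<n}. e * (g (m k) - g (m (k + 1))) \<le> m k - m (k + 1)"
  proof (intro eventually_ball_finite ballI)
    fix k assume k: "k \<in> {1..<n}"
    show "\<forall>\<^sub>F e in at_right 0. e * (g (m k) - g (m (k + 1))) \<le> m k - m (k + 1)"
    proof (cases "m k = m (k + 1)")
      case False
      have "((\<lambda>e. e * (g (m k) - g (m (k + 1)))) \<longlongrightarrow> 0 * (g (m k) - g (m (k + 1)))) (at_right 0)"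
        by (intro tendsto_intros)
      moreover have "0 * (g (m k) - g (m (k + 1))) < m k - m (k + 1)"
        using mono[OF k] False by simp
      ultimately have "\<forall>\<^sub>F e in at_right 0. e * (g (m k) - g (m (k + 1))) < m k - m (k + 1)"
        by (rule order_tendstoD)
      then show ?thesis by (rule eventually_mono) simp
    qed simp
  qed simp
  moreover have "\<forall>\<^sub>F e::real in at_right 0. 0 < e" by (simp add: eventually_at_right_less)
  ultimately have "\<forall>\<^sub>F e in at_right 0. 0 < e \<and>
      (\<forall>k\<in>{1..<n}. e * (g (m k) - g (m (k + 1))) \<le> m k - m (k + 1))"
    by (rule eventually_conj[rotated])
  then obtain e where e: "0 < e"
    "\<And>k. k \<in> {1..<n} \<Longrightarrow> e * (g (m k) - g (m (k + 1))) \<le> m k - m (k + 1)"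
    by (metis (no_types, lifting) eventually_happens' trivial_limit_at_right_real)
  then have "nonincreasing_along n id (\<lambda>i. m i - e * g (m i))"
    by (fastforce simp: nonincreasing_along_def algebra_simps)
  from fit_min_variational[OF m this permutes_id]
  have "- (e * (\<Sum>i=1..n. (x i - m i) * g (m i))) \<le> 0"
    by (simp add: sum_distrib_left sum_subtractf algebra_simps)
  then show ?thesis using e(1) by (simp add: m_def zero_le_mult_iff)
qed

text \<open>Nonexpansiveness bounds the change of a coordinate of the fit by a distance that
  involves finitely many coordinates of the data. Outside the index set the fit is constantly
  \<open>undefined\<close>.\<close>

lemma continuous_isotonic_fit:
  "continuous_on UNIV (\<lambda>x. isotonic_fit n id x i)"
proof (cases "i \<in> {1..n}")
  case True
  have "((\<lambda>y. isotonic_fit n id y i) \<longlongrightarrow> isotonic_fit n id x i) (at x)" for x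
  proof -
    have "((\<lambda>y. y j) \<longlongrightarrow> x j) (at x)" for j
      using continuous_on_product_coordinates[of j, where 'b=real] by (auto simp: continuous_on_def)
    then have "((\<lambda>y. sqrt (sq_dist n y x)) \<longlongrightarrow> sqrt (\<Sum>i=1..n. (x i - x i)\<^sup>2)) (at x)"
      unfolding sq_dist_def by (intro tendsto_intros)
    then have lim: "((\<lambda>y. sqrt (sq_dist n y x)) \<longlongrightarrow> 0) (at x)" by simp
    have "\<bar>isotonic_fit n id y i - isotonic_fit n id x i\<bar> \<le> sqrt (sq_dist n y x)" for y
    proof -
      have "(isotonic_fit n id y i - isotonic_fit n id x i)\<^sup>2
          \<le> sq_dist n (isotonic_fit n id y) (isotonic_fit n id x)"
        unfolding sq_dist_def using True by (intro member_le_sum) auto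
      also have "\<dots> \<le> sq_dist n y x"
        by (rule fit_min_nonexpansive[OF fit_min_isotonic_fit fit_min_isotonic_fit permutes_id])
      finally show ?thesis by (metis real_sqrt_abs real_sqrt_le_mono)
    qed
    then have "((\<lambda>y. isotonic_fit n id y i - isotonic_fit n id x i) \<longlongrightarrow> 0) (at x)"
      using lim by (intro Lim_null_comparison[OF _ lim]) auto
    then show ?thesis by (simp add: Lim_null[symmetric])
  qed
  then show ?thesis by (auto simp: continuous_on_def)
next
  case False
  have "isotonic_fit n id x i = undefined" for x :: "nat \<Rightarrow> real"
    using fit_min_isotonic_fit[of n x] False by (auto simp: is_arg_min_def extensional_def)
  then show ?thesis by simp
qed

subsection \<open>Swapping two neighbouring observations\<close>

text \<open>The argument lists the data in ranking order, so one fixed function serves all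
  permutations.\<close>

definition fit_util :: "nat \<Rightarrow> (real \<Rightarrow> real) \<Rightarrow> (nat \<Rightarrow> real) \<Rightarrow> real" where
  "fit_util n U y = (\<Sum>i=1..n. U (isotonic_fit n id y i))"

lemma fit_util_cong:
  "(\<And>i. i \<in> {1..n} \<Longrightarrow> x i = y i) \<Longrightarrow> fit_util n U x = fit_util n U y"
  using isotonic_fit_cong[of n x y id] by (simp add: fit_util_def)

lemma fit_util_permute:
  assumes "\<pi> permutes {1..n}"
  shows "(\<Sum>i=1..n. U (isotonic_fit n \<pi> x i)) = fit_util n U (x \<circ> \<pi>)"
  unfolding fit_util_def
  by (subst sum.permute[OF assms]) (auto intro!: sum.cong simp: isotonic_fit_permute[OF assms])

text \<open>The infimum of the slopes to the right, that is, the right derivative, is a subgradient.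
  Adding the subgradient inequalities at two points shows that it is monotone.\<close>

lemma convex_on_subgradient:
  fixes U :: "real \<Rightarrow> real"
  assumes "convex_on UNIV U"
  obtains g where "mono g" "\<And>x y. U x + g x * (y - x) \<le> U y"
proof
  define g where "g x = Inf ((\<lambda>t. (U x - U t) / (x - t)) ` ({x<..} \<inter> UNIV))" for x
  show *: "U x + g x * (y - x) \<le> U y" for x y
    unfolding g_def by (rule convex_le_Inf_differential[OF assms]) auto
  show "mono g"
  proof (rule monoI, rule ccontr)
    fix x y :: real assume "x \<le> y" "\<not> g x \<le> g y"
    then have "(y - x) * (g x - g y) > 0" by (intro mult_pos_pos) (auto simp: less_le)
    then show False using *[of x y] *[of y x] by (simp add: algebra_simps)
  qed
qed

lemma fit_util_swap_le:
  assumes U: "convex_on UNIV U" and k: "1 \<le> k" "k < n" and y: "y (k + 1) \<le> y k"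
  shows "fit_util n U (y \<circ> Transposition.transpose k (k + 1)) \<le> fit_util n U y"
proof -
  obtain g where g: "mono g" "\<And>x y. U x + g x * (y - x) \<le> U y"
    using convex_on_subgradient[OF U] by blast
  define y' where "y' = y \<circ> Transposition.transpose k (k + 1)"
  define m m' z where "m = isotonic_fit n id y" and "m' = isotonic_fit n id y'" and "z i = g (m' i)" for i
  have z: "nonincreasing_along n id z"
    using fit_min_isotonic_fit[of n y'] g(1)
    by (auto simp: is_arg_min_def nonincreasing_along_def z_def m'_def mono_def)
  have "(\<Sum>i=1..n. (y i - y' i) * z i) = (\<Sum>i\<in>{k, k+1}. (y i - y' i) * z i)"
    using k by (intro sum.mono_neutral_right) (auto simp: y'_def transpose_apply_other)
  also have "\<dots> = (y k - y (k + 1)) * (z k - z (k + 1))"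
    by (simp add: y'_def algebra_simps)
  also have "\<dots> \<ge> 0" using y z k by (auto simp: nonincreasing_along_def)
  finally have "0 \<le> (\<Sum>i=1..n. (y i - y' i) * z i)" .
  moreover have "0 \<le> (\<Sum>i=1..n. (y' i - m' i) * z i)"
    using isotonic_fit_orthogonal[of y' n g] by (simp add: m'_def z_def)
  moreover have "(\<Sum>i=1..n. (y i - m i) * z i) \<le> 0"
    using isotonic_fit_normal_cone[OF z, of y] by (simp add: m_def)
  moreover have "(\<Sum>i=1..n. z i * (m i - m' i)) = (\<Sum>i=1..n. (y i - y' i) * z i)
      + (\<Sum>i=1..n. (y' i - m' i) * z i) - (\<Sum>i=1..n. (y i - m i) * z i)"
    by (simp add: algebra_simps flip: sum.distrib sum_subtractf)
  ultimately have "0 \<le> (\<Sum>i=1..n. z i * (m i - m' i))" by linarith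
  then have "fit_util n U y' \<le> fit_util n U y' + (\<Sum>i=1..n. z i * (m i - m' i))" by simp
  also have "\<dots> = (\<Sum>i=1..n. U (m' i) + g (m' i) * (m i - m' i))"
    by (simp add: fit_util_def m'_def z_def sum.distrib)
  also have "\<dots> \<le> (\<Sum>i=1..n. U (m i))" by (intro sum_mono g(2))
  finally show ?thesis by (simp add: fit_util_def m_def y'_def)
qed

text \<open>Continuity gives measurability on the space of all sequences. Padding with zeros outside
  \<open>{1..n}\<close> leaves the utility unchanged and transfers this to the finite
  product.\<close>

lemma measurable_fit_util:
  assumes U: "U \<in> borel_measurable borel"
  shows "fit_util n U \<in> borel_measurable (PiM {1..n} (\<lambda>_. borel))"
proof -
  have "(\<lambda>y. isotonic_fit n id y i) \<in> borel_measurable (PiM UNIV (\<lambda>_. borel))" for i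
    using borel_measurable_continuous_onI[OF continuous_isotonic_fit[of n i]]
    by (simp cong: measurable_cong_sets add: sets_PiM_equal_borel)
  then have *: "fit_util n U \<in> borel_measurable (PiM UNIV (\<lambda>_. borel))"
    unfolding fit_util_def by (intro borel_measurable_sum measurable_compose[OF _ U]) auto
  have "(\<lambda>y i. if i \<in> {1..n} then y i else (0::real)) \<in> PiM {1..n} (\<lambda>_. borel) \<rightarrow>\<^sub>M PiM UNIV (\<lambda>_. borel)"
  proof (intro measurable_PiM_single')
    fix i
    show "(\<lambda>y. if i \<in> {1..n} then y i else (0::real)) \<in> borel_measurable (PiM {1..n} (\<lambda>_. borel))"
      by (cases "i \<in> {1..n}") (simp_all del: atLeastAtMost_iff)
  qed auto
  from measurable_compose[OF this *] show ?thesis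
    by (rule measurable_cong[THEN iffD1, rotated]) (auto intro!: fit_util_cong)
qed

subsection \<open>Rearrangement under a monotone likelihood ratio\<close>

text \<open>With increments \<open>b = a + d\<close> and \<open>A = B + e\<close>, the right side
  exceeds the left by \<open>e * d\<close>; this avoids subtraction of possibly infinite
  values.\<close>

lemma ennreal_rearrangement:
  fixes a b A B :: ennreal
  assumes "a \<le> b" "B \<le> A"
  shows "A * a + B * b \<le> A * b + B * a"
proof -
  obtain d e where d: "b = a + d" and e: "A = B + e"
    using assms by (auto simp: le_iff_add)
  show ?thesis unfolding d e
    by (simp add: distrib_left distrib_right add_ac add_left_mono)
qed

text \<open>Symmetrizing in \<open>u\<close> and \<open>v\<close> reduces the claim to the pointwise rearrangement inequality.\<close>

lemma nn_integral_pair_density_le: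
  fixes r :: "real \<Rightarrow> ennreal" and \<phi> :: "real \<Rightarrow> real \<Rightarrow> ennreal"
  assumes P: "sigma_finite_measure P" "sets P = sets borel"
    and r[measurable]: "r \<in> borel_measurable borel" and "antimono r"
    and \<phi>[measurable]: "case_prod \<phi> \<in> borel_measurable (borel \<Otimes>\<^sub>M borel)"
    and \<phi>_le: "\<And>u v. v \<le> u \<Longrightarrow> \<phi> v u \<le> \<phi> u v"
  shows "(\<integral>\<^sup>+v. \<integral>\<^sup>+u. \<phi> u v \<partial>density P r \<partial>P) \<le> (\<integral>\<^sup>+v. \<integral>\<^sup>+u. \<phi> u v \<partial>P \<partial>density P r)"
proof -
  interpret P: sigma_finite_measure P by fact
  interpret PP: pair_sigma_finite P P by standard
  note [measurable_cong] = P(2)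
  have \<phi>'[measurable]: "case_prod (\<lambda>u v. \<phi> v u) \<in> borel_measurable (borel \<Otimes>\<^sub>M borel)"
    using measurable_compose[OF measurable_pair_swap' \<phi>] by (simp add: case_prod_beta')
  have symm: "(\<integral>\<^sup>+v. \<integral>\<^sup>+u. \<psi> u v \<partial>P \<partial>P) = (\<integral>\<^sup>+v. \<integral>\<^sup>+u. \<psi> v u \<partial>P \<partial>P)"
    if [measurable]: "case_prod \<psi> \<in> borel_measurable (P \<Otimes>\<^sub>M P)" for \<psi> :: "real \<Rightarrow> real \<Rightarrow> ennreal"
    by (rule PP.Fubini') fact
  \<comment> \<open>With the density moved into the integrand, both sides integrate over
    \<open>P\<close> twice and differ only in whether \<open>r\<close> is evaluated at
    \<open>u\<close> or at \<open>v\<close>.\<close>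
  define L where "L = (\<integral>\<^sup>+v. \<integral>\<^sup>+u. \<phi> u v * r u \<partial>P \<partial>P)"
  define R where "R = (\<integral>\<^sup>+v. \<integral>\<^sup>+u. \<phi> u v * r v \<partial>P \<partial>P)"
  have L: "(\<integral>\<^sup>+v. \<integral>\<^sup>+u. \<phi> u v \<partial>density P r \<partial>P) = L"
    unfolding L_def by (intro nn_integral_cong) (simp add: nn_integral_density mult.commute)
  have R: "(\<integral>\<^sup>+v. \<integral>\<^sup>+u. \<phi> u v \<partial>P \<partial>density P r) = R"
    unfolding R_def by (subst nn_integral_density) (auto simp: nn_integral_cmult mult.commute)
  have L': "L = (\<integral>\<^sup>+v. \<integral>\<^sup>+u. \<phi> v u * r v \<partial>P \<partial>P)"
    unfolding L_def by (rule symm) measurable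
  have R': "R = (\<integral>\<^sup>+v. \<integral>\<^sup>+u. \<phi> v u * r u \<partial>P \<partial>P)"
    unfolding R_def by (rule symm) measurable
  have "L + L = (\<integral>\<^sup>+v. \<integral>\<^sup>+u. \<phi> u v * r u + \<phi> v u * r v \<partial>P \<partial>P)"
    by (subst (2) L') (simp add: L_def nn_integral_add)
  also have "\<dots> \<le> (\<integral>\<^sup>+v. \<integral>\<^sup>+u. \<phi> u v * r v + \<phi> v u * r u \<partial>P \<partial>P)"
  proof (intro nn_integral_mono)
    fix u v
    show "\<phi> u v * r u + \<phi> v u * r v \<le> \<phi> u v * r v + \<phi> v u * r u"
    proof (cases "v \<le> u")
      case True
      then show ?thesis
        using \<phi>_le[OF True] \<open>antimono r\<close> by (intro ennreal_rearrangement) (auto intro: antimonoD)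
    next
      case False
      then have "\<phi> v u * r v + \<phi> u v * r u \<le> \<phi> v u * r u + \<phi> u v * r v"
        using \<phi>_le[of u v] \<open>antimono r\<close> by (intro ennreal_rearrangement) (auto intro: antimonoD)
      then show ?thesis by (simp add: add.commute)
    qed
  qed
  also have "\<dots> = R + R"
    by (subst (2) R') (simp add: R_def nn_integral_add)
  finally have "2 * L \<le> 2 * R" by (simp add: mult_2)
  then have "L \<le> R" by (simp add: ennreal_mult_le_mult_iff)
  then show ?thesis by (simp only: L R)
qed

lemma nn_integral_PiM_insert2:
  assumes "product_sigma_finite D" and J: "finite J" "k \<notin> J" "l \<notin> J" "k \<noteq> l"
    and f[measurable]: "f \<in> borel_measurable (PiM (insert k (insert l J)) D)"
  shows "(\<integral>\<^sup>+y. f y \<partial>PiM (insert k (insert l J)) D) =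
    (\<integral>\<^sup>+x. \<integral>\<^sup>+v. \<integral>\<^sup>+u. f (x(l := v, k := u)) \<partial>D k \<partial>D l \<partial>PiM J D)"
proof -
  interpret product_sigma_finite D by fact
  interpret sigma_finite_measure "D k" by (rule sigma_finite_measures)
  have "(\<integral>\<^sup>+y. f y \<partial>PiM (insert k (insert l J)) D) =
      (\<integral>\<^sup>+x. \<integral>\<^sup>+u. f (x(k := u)) \<partial>D k \<partial>PiM (insert l J) D)"
    using J by (intro product_nn_integral_insert) auto
  also have "\<dots> = (\<integral>\<^sup>+x. \<integral>\<^sup>+v. \<integral>\<^sup>+u. f (x(l := v, k := u)) \<partial>D k \<partial>D l \<partial>PiM J D)"
    using J by (intro product_nn_integral_insert) auto
  finally show ?thesis .
qed

text \<open>For fixed remaining coordinates this is the two-variable inequality. That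
  \<open>r\<close> is decreasing means that \<open>D k\<close> dominates \<open>D l\<close> in the
  likelihood ratio order, so the larger observation tends to sit at \<open>k\<close> under
  \<open>D\<close>.\<close>

lemma nn_integral_PiM_swap_le:
  fixes D :: "nat \<Rightarrow> real measure" and f :: "(nat \<Rightarrow> real) \<Rightarrow> ennreal"
  assumes D: "\<And>i. prob_space (D i)" "\<And>i. sets (D i) = sets borel"
    and I: "finite I" "k \<in> I" "l \<in> I" "k \<noteq> l"
    and r: "r \<in> borel_measurable borel" "antimono r" "D l = density (D k) r"
    and f: "f \<in> borel_measurable (PiM I (\<lambda>_. borel))"
    and f_le: "\<And>y. y l \<le> y k \<Longrightarrow> f (y \<circ> Transposition.transpose k l) \<le> f y"
  shows "(\<integral>\<^sup>+y. f y \<partial>PiM I (D \<circ> Transposition.transpose k l)) \<le> (\<integral>\<^sup>+y. f y \<partial>PiM I D)"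
proof -
  let ?D = "D \<circ> Transposition.transpose k l"
  define J where "J = I - {k, l}"
  have J: "finite J" "k \<notin> J" "l \<notin> J" "k \<noteq> l" "I = insert k (insert l J)"
    using I by (auto simp: J_def)
  have ps: "product_sigma_finite D" "product_sigma_finite ?D"
    using D(1) by (auto simp: product_sigma_finite_def intro: prob_space_imp_sigma_finite)
  have setsJ: "sets (PiM J D) = sets (PiM J (\<lambda>_. borel))"
    using D(2) by (intro sets_PiM_cong) auto
  have D_J: "PiM J ?D = PiM J D"
    using J by (intro PiM_cong) (auto simp: Transposition.transpose_def)
  have "sets (PiM I D) = sets (PiM I (\<lambda>_. borel))" "sets (PiM I ?D) = sets (PiM I (\<lambda>_. borel))"
    using D(2) by (auto intro!: sets_PiM_cong)
  then have fD: "f \<in> borel_measurable (PiM I D)" "f \<in> borel_measurable (PiM I ?D)"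
    using f by (simp_all cong: measurable_cong_sets)
  \<comment> \<open>Under \<open>?D\<close> coordinate \<open>k\<close> has the law
    \<open>D l = density (D k) r\<close>, and coordinate \<open>l\<close> has the law
    \<open>D k\<close>.\<close>
  have "(\<integral>\<^sup>+y. f y \<partial>PiM I ?D) =
      (\<integral>\<^sup>+x. \<integral>\<^sup>+v. \<integral>\<^sup>+u. f (x(l := v, k := u)) \<partial>density (D k) r \<partial>D k \<partial>PiM J D)"
    using nn_integral_PiM_insert2[OF ps(2) J(1-4)] fD(2) D_J r(3) unfolding J(5) by simp
  also have "\<dots> \<le> (\<integral>\<^sup>+x. \<integral>\<^sup>+v. \<integral>\<^sup>+u. f (x(l := v, k := u)) \<partial>D k \<partial>density (D k) r \<partial>PiM J D)"
  proof (intro nn_integral_mono nn_integral_pair_density_le r D)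
    fix x assume "x \<in> space (PiM J D)"
    then have x: "x \<in> space (PiM J (\<lambda>_. borel))"
      using setsJ sets_eq_imp_space_eq by blast
    have "(\<lambda>(u, v). x(l := v, k := u)) \<in> borel \<Otimes>\<^sub>M borel \<rightarrow>\<^sub>M PiM I (\<lambda>_. borel)"
    proof (intro measurable_PiM_single')
      fix i
      have "(\<lambda>z::real \<times> real. (x(l := snd z, k := fst z)) i) =
          (if i = k then fst else if i = l then snd else (\<lambda>_. x i))"
        by (simp add: fun_eq_iff)
      then show "(\<lambda>z. (case z of (u, v) \<Rightarrow> x(l := v, k := u)) i) \<in> borel_measurable (borel \<Otimes>\<^sub>M borel)"
        by (simp add: case_prod_beta')
    next
      show "(\<lambda>(u, v). x(l := v, k := u)) \<in> space (borel \<Otimes>\<^sub>M borel) \<rightarrow> (\<Pi>\<^sub>E i\<in>I. space borel)"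
        using x J(5) by (auto simp: space_PiM PiE_def extensional_def)
    qed
    from measurable_compose[OF this f]
    show "(\<lambda>(u, v). f (x(l := v, k := u))) \<in> borel_measurable (borel \<Otimes>\<^sub>M borel)"
      by (simp add: case_prod_beta')
  next
    show "sigma_finite_measure (D k)" by (intro prob_space_imp_sigma_finite D)
  next
    fix x :: "nat \<Rightarrow> real" and u v :: real assume "v \<le> u"
    have "x(l := u, k := v) = x(l := v, k := u) \<circ> Transposition.transpose k l"
      using I(4) by (auto simp: fun_eq_iff transpose_def)
    then show "f (x(l := u, k := v)) \<le> f (x(l := v, k := u))"
      using f_le[of "x(l := v, k := u)"] \<open>v \<le> u\<close> I(4) by simp
  qed
  also have "\<dots> = (\<integral>\<^sup>+y. f y \<partial>PiM I D)"
    using nn_integral_PiM_insert2[OF ps(1) J(1-4)] fD(1) r(3) unfolding J(5) by simp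
  finally show ?thesis .
qed

text \<open>The positive part of \<open>F\<close> increases and the negative part decreases. Subtraction on
  \<^typ>\<open>ereal\<close> is monotone even where it yields \<open>\<infinity> - \<infinity> = \<infinity>\<close>, so finiteness plays no role.\<close>

lemma ext_expectation_PiM_swap_le:
  fixes D :: "nat \<Rightarrow> real measure" and F :: "(nat \<Rightarrow> real) \<Rightarrow> real"
  assumes D: "\<And>i. prob_space (D i)" "\<And>i. sets (D i) = sets borel"
    and I: "finite I" "k \<in> I" "l \<in> I" "k \<noteq> l"
    and r: "r \<in> borel_measurable borel" "antimono r" "D l = density (D k) r"
    and F: "F \<in> borel_measurable (PiM I (\<lambda>_. borel))"
    and F_le: "\<And>y. y l \<le> y k \<Longrightarrow> F (y \<circ> Transposition.transpose k l) \<le> F y"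
  shows "ext_expectation (PiM I (D \<circ> Transposition.transpose k l)) F \<le> ext_expectation (PiM I D) F"
proof -
  let ?t = "Transposition.transpose k l"
  let ?D = "D \<circ> ?t"
  have invol: "g \<circ> ?t \<circ> ?t = g" for g :: "nat \<Rightarrow> 'c" by (simp add: comp_assoc)
  have "(\<integral>\<^sup>+y. ennreal (F y) \<partial>PiM I ?D) \<le> (\<integral>\<^sup>+y. ennreal (F y) \<partial>PiM I D)"
    using F F_le by (intro nn_integral_PiM_swap_le[where r = r] D I r) (auto intro!: ennreal_leI)
  \<comment> \<open>For \<open>- F\<close> the roles of \<open>k\<close> and \<open>l\<close> are
    exchanged: the swap now starts from \<open>?D\<close>, where \<open>l\<close> carries the
    dominating law, and leads back to \<open>D\<close>.\<close>
  moreover have "(\<integral>\<^sup>+y. ennreal (- F y) \<partial>PiM I (?D \<circ> ?t)) \<le> (\<integral>\<^sup>+y. ennreal (- F y) \<partial>PiM I ?D)"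
    unfolding transpose_commute[of k l]
  proof (intro nn_integral_PiM_swap_le[where r = r])
    fix y :: "nat \<Rightarrow> real" assume "y k \<le> y l"
    then have "F (y \<circ> ?t \<circ> ?t) \<le> F (y \<circ> ?t)" by (intro F_le) simp
    then show "ennreal (- F (y \<circ> Transposition.transpose l k)) \<le> ennreal (- F y)"
      unfolding invol transpose_commute[of l k] by (intro ennreal_leI) simp
  qed (use D I r F in \<open>auto simp: Transposition.transpose_def\<close>)
  ultimately show ?thesis
    unfolding ext_expectation_def invol
    by (intro ereal_minus_mono) (auto simp: less_eq_ennreal.rep_eq)
qed

subsection \<open>Exponential families\<close>

text \<open>The carrier is a common factor, so the likelihood ratio is the exponential of an affine
  function of \<open>x\<close>, with slope \<open>\<theta>' - \<theta>\<close>.\<close>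

lemma exp_family_law_density:
  assumes "regular_exp_family \<rho> c \<Theta> b"
  shows "exp_family_law \<rho> c b \<theta>' =
    density (exp_family_law \<rho> c b \<theta>) (\<lambda>x. ennreal (exp ((\<theta>' - \<theta>) * x - (b \<theta>' - b \<theta>))))"
proof -
  have [measurable]: "c \<in> borel_measurable borel" and [measurable_cong]: "sets \<rho> = sets borel" and c: "\<And>x. 0 \<le> c x"
    using assms by (auto simp: regular_exp_family_def)
  have "ennreal (exp (\<theta> * x - b \<theta>) * c x) * ennreal (exp ((\<theta>' - \<theta>) * x - (b \<theta>' - b \<theta>)))
      = ennreal (exp (\<theta>' * x - b \<theta>') * c x)" for x
  proof -
    have "exp (\<theta> * x - b \<theta>) * exp ((\<theta>' - \<theta>) * x - (b \<theta>' - b \<theta>)) = exp (\<theta>' * x - b \<theta>')"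
      by (simp add: algebra_simps flip: exp_add)
    then have "(exp (\<theta> * x - b \<theta>) * c x) * exp ((\<theta>' - \<theta>) * x - (b \<theta>' - b \<theta>)) = exp (\<theta>' * x - b \<theta>') * c x"
      by (metis mult.assoc mult.commute)
    then show ?thesis by (simp only: ennreal_mult''[OF exp_ge_zero, symmetric])
  qed
  then show ?thesis
    unfolding exp_family_law_def by (subst density_density_eq) simp_all
qed

text \<open>This is the total mass 1 of the law at \<open>\<theta>'\<close>, written as an integral
  against the law at \<open>\<theta>\<close>.\<close>

lemma exp_family_law_exp:
  assumes E: "regular_exp_family \<rho> c \<Theta> b" and \<theta>: "\<theta> \<in> \<Theta>" "\<theta>' \<in> \<Theta>"
  shows "integrable (exp_family_law \<rho> c b \<theta>) (\<lambda>x. exp ((\<theta>' - \<theta>) * x - (b \<theta>' - b \<theta>)))" (is ?i)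
    and "(\<integral>x. exp ((\<theta>' - \<theta>) * x - (b \<theta>' - b \<theta>)) \<partial>exp_family_law \<rho> c b \<theta>) = 1" (is ?e)
proof -
  have sets: "sets (exp_family_law \<rho> c b \<theta>) = sets borel"
    using E by (simp add: regular_exp_family_def exp_family_law_def)
  note [measurable_cong] = sets
  interpret P': prob_space "exp_family_law \<rho> c b \<theta>'"
    using E \<theta> by (simp add: regular_exp_family_def)
  have "1 = emeasure (exp_family_law \<rho> c b \<theta>') (space (exp_family_law \<rho> c b \<theta>'))"
    by (simp add: P'.emeasure_space_1)
  also have "\<dots> = (\<integral>\<^sup>+x. ennreal (exp ((\<theta>' - \<theta>) * x - (b \<theta>' - b \<theta>))) \<partial>exp_family_law \<rho> c b \<theta>)"
    by (subst (1 2) exp_family_law_density[OF E, of \<theta>' \<theta>]) (simp add: emeasure_density cong: nn_integral_cong)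
  finally have *: "(\<integral>\<^sup>+x. ennreal (exp ((\<theta>' - \<theta>) * x - (b \<theta>' - b \<theta>))) \<partial>exp_family_law \<rho> c b \<theta>) = 1"
    by simp
  then show ?i by (intro integrableI_nonneg) auto
  show ?e using * by (subst integral_eq_nn_integral) auto
qed

text \<open>As \<Theta> is open, exponential moments exist at some \<open>e\<close> and
  \<open>- e\<close>, and together they dominate the absolute value.\<close>

lemma exp_family_law_integrable:
  assumes E: "regular_exp_family \<rho> c \<Theta> b" and \<theta>: "\<theta> \<in> \<Theta>"
  shows "integrable (exp_family_law \<rho> c b \<theta>) (\<lambda>x. x)"
proof -
  let ?P = "exp_family_law \<rho> c b \<theta>"
  have [measurable_cong]: "sets ?P = sets borel"
    using E by (simp add: regular_exp_family_def exp_family_law_def)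
  obtain e where e: "e > 0" "cball \<theta> e \<subseteq> \<Theta>"
    using E \<theta> by (auto simp: regular_exp_family_def open_contains_cball)
  have int: "integrable ?P (\<lambda>x. exp (d * x))" if "\<theta> + d \<in> \<Theta>" for d
  proof -
    have "integrable ?P (\<lambda>x. exp (b (\<theta> + d) - b \<theta>) * exp (d * x - (b (\<theta> + d) - b \<theta>)))"
      using exp_family_law_exp(1)[OF E \<theta> that] by (intro integrable_mult_right) simp
    then show ?thesis by (simp flip: exp_add)
  qed
  have "\<theta> + e \<in> \<Theta>" "\<theta> + - e \<in> \<Theta>"
    using e by (auto simp: dist_real_def subset_iff)
  then have "integrable ?P (\<lambda>x. (exp (e * x) + exp (- e * x)) / e)"
    by (intro integrable_divide Bochner_Integration.integrable_add int)
  then show ?thesis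
  proof (rule Bochner_Integration.integrable_bound)
    have "\<bar>x\<bar> \<le> (exp (e * x) + exp (- e * x)) / e" for x
    proof -
      have "e * x \<le> exp (e * x)" "- e * x \<le> exp (- e * x)" "0 < exp (e * x)" "0 < exp (- e * x)"
        using exp_ge_add_one_self[of "e * x"] exp_ge_add_one_self[of "- e * x"] exp_gt_zero[of "e * x"]
          exp_gt_zero[of "- e * x"] by linarith+
      then have "e * x \<le> exp (e * x) + exp (- e * x)" "- (e * x) \<le> exp (e * x) + exp (- e * x)"
        by linarith+
      then have "e * \<bar>x\<bar> \<le> exp (e * x) + exp (- e * x)"
        using e(1) by (cases "x < 0") simp_all
      then show ?thesis using e(1) by (simp add: field_simps)
    qed
    then show "AE x in ?P. norm x \<le> norm ((exp (e * x) + exp (- e * x)) / e)"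
      using e(1) by (auto simp: add_nonneg_nonneg)
  qed simp
qed

text \<open>With \<open>T x = (\<theta>' - \<theta>) * x - (b \<theta>' - b \<theta>)\<close>, the inequality \<open>1 + T \<le> exp T\<close> is integrated
  against \<open>P\<^sub>\<theta>\<close>, where \<open>exp T\<close> has mean 1. Equality forces \<open>T = 0\<close> almost surely.\<close>

lemma exp_family_law_mean_le:
  assumes E: "regular_exp_family \<rho> c \<Theta> b" and \<theta>: "\<theta> \<in> \<Theta>" "\<theta>' \<in> \<Theta>"
  shows "(\<theta>' - \<theta>) * (\<integral>x. x \<partial>exp_family_law \<rho> c b \<theta>) \<le> b \<theta>' - b \<theta>" (is ?le)
    and "(\<theta>' - \<theta>) * (\<integral>x. x \<partial>exp_family_law \<rho> c b \<theta>) = b \<theta>' - b \<theta> \<Longrightarrow>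
      exp_family_law \<rho> c b \<theta>' = exp_family_law \<rho> c b \<theta>"
proof -
  let ?P = "exp_family_law \<rho> c b \<theta>"
  let ?T = "\<lambda>x. (\<theta>' - \<theta>) * x - (b \<theta>' - b \<theta>)"
  have sets: "sets ?P = sets borel"
    using E by (simp add: regular_exp_family_def exp_family_law_def)
  interpret P: prob_space ?P
    using E \<theta> by (simp add: regular_exp_family_def)
  have ge: "0 \<le> exp (?T x) - 1 - ?T x" for x
    using exp_ge_add_one_self[of "?T x"] by linarith
  have int: "integrable ?P (\<lambda>x. exp (?T x) - 1 - ?T x)"
    using exp_family_law_exp(1)[OF E \<theta>] exp_family_law_integrable[OF E \<theta>(1)]
    by (intro Bochner_Integration.integrable_diff integrable_mult_right) auto
  have eq: "(\<integral>x. exp (?T x) - 1 - ?T x \<partial>?P) = b \<theta>' - b \<theta> - (\<theta>' - \<theta>) * (\<integral>x. x \<partial>?P)"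
    using exp_family_law_exp[OF E \<theta>] exp_family_law_integrable[OF E \<theta>(1)]
    by (simp add: P.prob_space)
  have "0 \<le> (\<integral>x. exp (?T x) - 1 - ?T x \<partial>?P)"
    by (intro Bochner_Integration.integral_nonneg ge)
  then show ?le using eq by simp
  assume "(\<theta>' - \<theta>) * (\<integral>x. x \<partial>?P) = b \<theta>' - b \<theta>"
  then have "(\<integral>x. exp (?T x) - 1 - ?T x \<partial>?P) = 0" using eq by simp
  then have "AE x in ?P. exp (?T x) - 1 - ?T x = 0"
    using integral_nonneg_eq_0_iff_AE[OF int] ge by simp
  then have "AE x in ?P. ennreal (exp (?T x)) = 1"
  proof (rule AE_mp, intro AE_I2 impI)
    fix x assume "exp (?T x) - 1 - ?T x = 0"
    \<comment> \<open>The value \<open>w = exp (?T x)\<close> satisfies \<open>ln w = w - 1\<close>,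
      which holds only at 1.\<close>
    then have "exp (?T x) = 1" by (intro ln_eq_minus_one) auto
    then show "ennreal (exp (?T x)) = 1" by simp
  qed
  then have "density ?P (\<lambda>x. ennreal (exp (?T x))) = density ?P (\<lambda>_. 1)"
    by (intro density_cong) (simp_all add: measurable_cong_sets[OF sets refl])
  then show "exp_family_law \<rho> c b \<theta>' = ?P"
    unfolding exp_family_law_density[OF E, of \<theta>' \<theta>] density_1 .
qed

text \<open>For \<open>\<theta>' \<le> \<theta>\<close> the exponential ratio itself is decreasing.
  Otherwise the mean inequalities at both parameters squeeze \<open>b \<theta>' - b \<theta>\<close>
  between multiples of the means that are ordered the other way; equality holds, the laws coincide,
  and the ratio 1 works.\<close>

lemma exp_family_antimono_likelihood_ratio:
  assumes E: "regular_exp_family \<rho> c \<Theta> b" and \<theta>: "\<theta> \<in> \<Theta>" "\<theta>' \<in> \<Theta>"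
    and mean: "(\<integral>x. x \<partial>exp_family_law \<rho> c b \<theta>') \<le> (\<integral>x. x \<partial>exp_family_law \<rho> c b \<theta>)"
  obtains r :: "real \<Rightarrow> ennreal" where "r \<in> borel_measurable borel" "antimono r"
    "exp_family_law \<rho> c b \<theta>' = density (exp_family_law \<rho> c b \<theta>) r"
proof (cases "\<theta>' \<le> \<theta>")
  case True
  have "antimono (\<lambda>x. ennreal (exp ((\<theta>' - \<theta>) * x - (b \<theta>' - b \<theta>))))"
    using True by (auto simp: antimono_def intro!: ennreal_leI mult_left_mono_neg)
  then show ?thesis
    using exp_family_law_density[OF E, of \<theta>' \<theta>] by (intro that) auto
next
  case False
  then have "(\<theta>' - \<theta>) * (\<integral>x. x \<partial>exp_family_law \<rho> c b \<theta>') \<le> (\<theta>' - \<theta>) * (\<integral>x. x \<partial>exp_family_law \<rho> c b \<theta>)"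
    using mean by (intro mult_left_mono) auto
  then have "(\<theta>' - \<theta>) * (\<integral>x. x \<partial>exp_family_law \<rho> c b \<theta>) = b \<theta>' - b \<theta>"
    using exp_family_law_mean_le(1)[OF E \<theta>] exp_family_law_mean_le(1)[OF E \<theta>(2,1)]
    by (simp add: algebra_simps)
  then have "exp_family_law \<rho> c b \<theta>' = density (exp_family_law \<rho> c b \<theta>) (\<lambda>_. 1)"
    unfolding density_1 by (rule exp_family_law_mean_le(2)[OF E \<theta>])
  then show ?thesis by (intro that[of "\<lambda>_. 1"]) (auto simp: antimono_def)
qed

subsection \<open>Sorting by adjacent transpositions\<close>

lemma permutes_increasing_eq_id:
  assumes \<sigma>: "\<sigma> permutes {1..n::nat}" and inc: "\<And>k. 1 \<le> k \<Longrightarrow> k < n \<Longrightarrow> \<sigma> k < \<sigma> (k + 1)"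
  shows "\<sigma> = id"
proof (rule permutes_natset_ge[OF \<sigma>], rule ballI)
  fix i assume "i \<in> {1..n}"
  then have "1 \<le> i" "i \<le> n" by auto
  then show "i \<le> \<sigma> i"
  proof (induction i rule: dec_induct)
    case base
    then show ?case using permutes_in_image[OF \<sigma>, of 1] by simp
  next
    case (step m)
    then show ?case using inc[of m] by simp
  qed
qed

text \<open>Bubble sort: removing a descent at \<open>k\<close> raises the sum of
  \<open>i * \<sigma> i\<close> by \<open>\<sigma> k - \<sigma> (k + 1)\<close>. This sum is
  bounded, so the process ends, and it can only end at \<open>id\<close>.\<close>

lemma permutes_sort_induct [consumes 1, case_names swap]:
  assumes \<sigma>: "\<sigma> permutes {1..n::nat}"
    and swap: "\<And>\<sigma> k. \<sigma> permutes {1..n} \<Longrightarrow> 1 \<le> k \<Longrightarrow> k < n \<Longrightarrow> \<sigma> (k + 1) < \<sigma> k \<Longrightarrow>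
      H \<sigma> \<le> H (\<sigma> \<circ> Transposition.transpose k (k + 1))"
  shows "H \<sigma> \<le> (H id :: 'a::order)"
  using \<sigma>
proof (induction "n * n * n - (\<Sum>i=1..n. i * \<sigma> i)" arbitrary: \<sigma> rule: less_induct)
  case less
  note \<sigma> = less.prems
  show ?case
  proof (cases "\<exists>k. 1 \<le> k \<and> k < n \<and> \<sigma> (k + 1) < \<sigma> k")
    case False
    have "\<sigma> k \<noteq> \<sigma> (k + 1)" for k
      by (simp add: inj_eq[OF permutes_inj[OF \<sigma>]])
    with False have "\<sigma> = id"
      by (metis permutes_increasing_eq_id[OF \<sigma>] linorder_neqE_nat)
    then show ?thesis by simp
  next
    case True
    then obtain k where k: "1 \<le> k" "k < n" "\<sigma> (k + 1) < \<sigma> k" by blast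
    let ?\<tau> = "\<sigma> \<circ> Transposition.transpose k (k + 1)"
    have \<tau>: "?\<tau> permutes {1..n}"
      using k by (intro permutes_compose[OF _ \<sigma>] permutes_swap_id) auto
    have split: "(\<Sum>i=1..n. i * p i) = (\<Sum>i\<in>{1..n} - {k, k + 1}. i * p i) + (k * p k + (k + 1) * p (k + 1))"
      for p :: "nat \<Rightarrow> nat"
    proof -
      have "(\<Sum>i=1..n. i * p i) = (\<Sum>i\<in>{1..n} - {k, k + 1}. i * p i) + (\<Sum>i\<in>{k, k + 1}. i * p i)"
        using k by (intro sum.subset_diff) auto
      then show ?thesis by simp
    qed
    have "(\<Sum>i\<in>{1..n} - {k, k + 1}. i * ?\<tau> i) = (\<Sum>i\<in>{1..n} - {k, k + 1}. i * \<sigma> i)"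
      by (intro sum.cong) (auto simp: Transposition.transpose_def)
    then have lt: "(\<Sum>i=1..n. i * \<sigma> i) < (\<Sum>i=1..n. i * ?\<tau> i)"
      using k(3) unfolding split[of \<sigma>] split[of ?\<tau>] by (simp add: algebra_simps)
    \<comment> \<open>Subtraction on naturals truncates, so a strict decrease of the measure
      requires the old sum to lie below \<open>n * n * n\<close>.\<close>
    have "(\<Sum>i=1..n. i * ?\<tau> i) \<le> of_nat (card {1..n}) * (n * n)"
      using permutes_in_image[OF \<tau>] by (intro sum_bounded_above mult_mono) auto
    then have "n * n * n - (\<Sum>i=1..n. i * ?\<tau> i) < n * n * n - (\<Sum>i=1..n. i * \<sigma> i)"
      using lt by (intro diff_less_mono2) auto
    then have "H ?\<tau> \<le> H id" using less.hyps \<tau> by blast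
    with swap[OF \<sigma> k] show ?thesis by (rule order_trans)
  qed
qed

section \<open>Laws of permuted samples and the comparison of rankings\<close>

text \<open>Independence makes the joint law a product measure, and products can be reindexed along
  a permutation.\<close>

lemma (in prob_space) distr_permuted_indep_vars:
  assumes "\<pi> permutes I" "I \<noteq> {}" "indep_vars (\<lambda>_. N) X I" "\<And>i. random_variable N (X i)"
  shows "distr M (PiM I (\<lambda>_. N)) (\<lambda>\<omega>. \<lambda>i\<in>I. X (\<pi> i) \<omega>) = PiM I (\<lambda>i. distr M N (X (\<pi> i)))"
proof -
  have in_range: "\<pi> i \<in> I" if "i \<in> I" for i using permutes_in_image[OF assms(1)] that by simp
  note [measurable] = assms(4)
  let ?D = "\<lambda>i. distr M N (X i)"
  have sets: "sets (PiM I (\<lambda>i. ?D (\<pi> i))) = sets (PiM I (\<lambda>_. N))"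
    by (intro sets_PiM_cong) auto
  have "PiM I (\<lambda>i. ?D (\<pi> i)) = distr (PiM I ?D) (PiM I (\<lambda>i. ?D (\<pi> i))) (\<lambda>\<omega>. \<lambda>i\<in>I. \<omega> (\<pi> i))"
    using in_range permutes_inj_on[OF assms(1)]
    by (intro distr_PiM_reindex[symmetric]) (auto intro: prob_space_distr)
  also have "\<dots> = distr (PiM I ?D) (PiM I (\<lambda>_. N)) (\<lambda>\<omega>. \<lambda>i\<in>I. \<omega> (\<pi> i))"
    using sets by (intro distr_cong) auto
  also have "PiM I ?D = distr M (PiM I (\<lambda>_. N)) (\<lambda>\<omega>. \<lambda>i\<in>I. X i \<omega>)"
    using assms by (subst (asm) indep_vars_iff_distr_eq_PiM) auto
  also have "distr \<dots> (PiM I (\<lambda>_. N)) (\<lambda>\<omega>. \<lambda>i\<in>I. \<omega> (\<pi> i)) =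
      distr M (PiM I (\<lambda>_. N)) ((\<lambda>\<omega>. \<lambda>i\<in>I. \<omega> (\<pi> i)) \<circ> (\<lambda>\<omega>. \<lambda>i\<in>I. X i \<omega>))"
    using in_range by (intro distr_distr) (auto intro!: measurable_restrict measurable_component_singleton)
  also have "(\<lambda>\<omega>. \<lambda>i\<in>I. \<omega> (\<pi> i)) \<circ> (\<lambda>\<omega>. \<lambda>i\<in>I. X i \<omega>) = (\<lambda>\<omega>. \<lambda>i\<in>I. X (\<pi> i) \<omega>)"
    using in_range by (auto simp: fun_eq_iff)
  finally show ?thesis by (rule sym)
qed

lemma ext_expectation_distr:
  assumes "g \<in> M \<rightarrow>\<^sub>M N" "f \<in> borel_measurable N"
  shows "ext_expectation (distr M N g) f = ext_expectation M (\<lambda>\<omega>. f (g \<omega>))"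
  using assms by (simp add: ext_expectation_def nn_integral_distr)

theorem theorem1:
  fixes M :: "'a measure" and X :: "nat \<Rightarrow> 'a \<Rightarrow> real"
    and \<rho> :: "real measure" and c b :: "real \<Rightarrow> real" and \<Theta> :: "real set"
    and \<theta> :: "nat \<Rightarrow> real" and U :: "real \<Rightarrow> real"
    and n :: nat and \<pi>s \<pi> :: "nat \<Rightarrow> nat"
  assumes "n \<ge> 2"
    and "regular_exp_family \<rho> c \<Theta> b"
    and "prob_space M"
    and "prob_space.indep_vars M (\<lambda>_. borel) X {1..n}"
    and "\<And>i. i \<in> {1..n} \<Longrightarrow> \<theta> i \<in> \<Theta>"
    and "\<And>i. i \<in> {1..n} \<Longrightarrow> distr M borel (X i) = exp_family_law \<rho> c b (\<theta> i)"
    and "\<pi>s permutes {1..n}"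
    and "nonincreasing_along n \<pi>s (\<lambda>i. prob_space.expectation M (X i))"
    and "mono U" and "convex_on UNIV U"
    and "\<pi> permutes {1..n}"
  shows "Util M n X U \<pi>s \<ge> Util M n X U \<pi>"
proof -
  interpret prob_space M by fact
  \<comment> \<open>Padding with the constant 0 makes every \<open>D i\<close> a probability
    measure, also for indices outside \<open>{1..n}\<close>, as the swap inequality
    requires.\<close>
  define Y where "Y i = (if i \<in> {1..n} then X i else (\<lambda>_. 0))" for i
  define D where "D i = distr M borel (Y i)" for i
  let ?F = "fit_util n U"
  have F: "?F \<in> borel_measurable (PiM {1..n} (\<lambda>_. borel))"
    by (intro measurable_fit_util borel_measurable_mono assms)
  have Y[measurable]: "random_variable borel (Y i)" for i
    using assms(4) by (auto simp: Y_def indep_vars_def)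
  have indep: "indep_vars (\<lambda>_. borel) Y {1..n}"
    using assms(4) by (subst indep_vars_cong[where Y = X and J = "{1..n}" and N' = "\<lambda>_. borel"]) (auto simp: Y_def)
  have D: "prob_space (D i)" "sets (D i) = sets borel" for i
    by (auto simp: D_def intro: prob_space_distr)
  have D_law: "D i = exp_family_law \<rho> c b (\<theta> i)" if "i \<in> {1..n}" for i
    using assms(6)[OF that] that by (simp add: D_def Y_def)
  have mean: "(\<integral>x. x \<partial>D i) = expectation (X i)" if "i \<in> {1..n}" for i
    using that by (simp add: D_def integral_distr) (simp add: Y_def)
  have Util_eq: "Util M n X U p = ext_expectation (PiM {1..n} (D \<circ> p)) ?F" if p: "p permutes {1..n}" for p
  proof -
    have in_range: "p i \<in> {1..n}" if "i \<in> {1..n}" for i using permutes_in_image[OF p] that by simp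
    have "Util M n X U p = ext_expectation M (\<lambda>\<omega>. ?F (\<lambda>i\<in>{1..n}. Y (p i) \<omega>))"
      unfolding Util_def fit_util_permute[OF p]
      using in_range by (intro arg_cong[where f = "ext_expectation M"] ext fit_util_cong) (auto simp: Y_def)
    also have "\<dots> = ext_expectation (distr M (PiM {1..n} (\<lambda>_. borel)) (\<lambda>\<omega>. \<lambda>i\<in>{1..n}. Y (p i) \<omega>)) ?F"
      by (intro ext_expectation_distr[symmetric] F measurable_restrict) (rule Y)
    also have "distr M (PiM {1..n} (\<lambda>_. borel)) (\<lambda>\<omega>. \<lambda>i\<in>{1..n}. Y (p i) \<omega>) = PiM {1..n} (D \<circ> p)"
      using distr_permuted_indep_vars[OF p _ indep Y] assms(1) by (simp add: D_def comp_def)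
    finally show ?thesis .
  qed
  have sorted: "expectation (X (\<pi>s j)) \<le> expectation (X (\<pi>s i))" if "1 \<le> i" "i \<le> j" "j \<le> n" for i j
    using that(2,3)
  proof (induction j rule: dec_induct)
    case (step m)
    then have "expectation (X (\<pi>s (Suc m))) \<le> expectation (X (\<pi>s m))"
      using assms(8) that(1) by (auto simp: nonincreasing_along_def)
    with step show ?case by simp
  qed simp
  \<comment> \<open>\<open>?\<sigma> i\<close> is the rank under \<open>\<pi>s\<close> of the
    observation that \<open>\<pi>\<close> puts in position \<open>i\<close>; sorting
    \<open>?\<sigma>\<close> to \<open>id\<close> turns \<open>\<pi>\<close> into
    \<open>\<pi>s\<close>.\<close>
  let ?\<sigma> = "inv \<pi>s \<circ> \<pi>"
  have "?\<sigma> permutes {1..n}"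
    by (intro permutes_compose permutes_inv assms)
  then have "ext_expectation (PiM {1..n} (D \<circ> (\<pi>s \<circ> ?\<sigma>))) ?F \<le> ext_expectation (PiM {1..n} (D \<circ> (\<pi>s \<circ> id))) ?F"
  proof (induction rule: permutes_sort_induct)
    case (swap \<sigma> k)
    have in_range: "\<sigma> i \<in> {1..n}" "\<pi>s i \<in> {1..n}" if "i \<in> {1..n}" for i
      using that permutes_in_image[OF swap(1)] permutes_in_image[OF assms(7)] by auto
    have k: "k \<in> {1..n}" "k + 1 \<in> {1..n}" using swap by auto
    have k': "\<sigma> k \<in> {1..n}" "\<sigma> (k + 1) \<in> {1..n}" using k in_range by auto
    \<comment> \<open>At a descent of \<open>\<sigma>\<close> the observation in position
      \<open>k + 1\<close> has the better rank under \<open>\<pi>s\<close>, hence at least as large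
      a mean.\<close>
    have "expectation (X (\<pi>s (\<sigma> k))) \<le> expectation (X (\<pi>s (\<sigma> (k + 1))))"
      using swap k' by (intro sorted) auto
    then obtain r :: "real \<Rightarrow> ennreal" where r: "r \<in> borel_measurable borel" "antimono r"
      "D (\<pi>s (\<sigma> k)) = density (D (\<pi>s (\<sigma> (k + 1)))) r"
      using exp_family_antimono_likelihood_ratio[OF assms(2), of "\<theta> (\<pi>s (\<sigma> (k + 1)))" "\<theta> (\<pi>s (\<sigma> k))"]
        mean D_law assms(5) in_range k k' by metis
    let ?t = "Transposition.transpose k (k + 1)"
    \<comment> \<open>\<open>?E\<close> lists the laws after the swap, with the larger mean in
      position \<open>k\<close>; a second transposition recovers the order before it.\<close>
    let ?E = "D \<circ> (\<pi>s \<circ> (\<sigma> \<circ> ?t))"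
    have "ext_expectation (PiM {1..n} (?E \<circ> ?t)) ?F \<le> ext_expectation (PiM {1..n} ?E) ?F"
      using swap k r F D assms(10)
      by (intro ext_expectation_PiM_swap_le[where r = r] fit_util_swap_le) auto
    also have "?E \<circ> ?t = D \<circ> (\<pi>s \<circ> \<sigma>)"
      by (simp add: comp_assoc)
    finally show ?case .
  qed
  moreover have "\<pi>s \<circ> ?\<sigma> = \<pi>"
    using permutes_inv_o(1)[OF assms(7)] by (simp flip: comp_assoc)
  ultimately show ?thesis
    by (simp add: Util_eq[OF assms(7)] Util_eq[OF assms(11)])
qed

end
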